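(* Let $k<K$ be a field extension and let $W_0$, $W_1$ be $k$-subspaces of $K$ such that, for each $i\in\{0,1\}$, the triple $k,K,W_i$ is tame. Let $Q_i=Q_{k<K}(W_i)$ for $i\in\{0,1\}$. Then $Q_0$ is isomorphic to $Q_1$ if and only if there is a field automorphism $\varphi\in\mathrm{Aut}(K)$ such that $W_0\varphi=W_1$.
   Context: Here $k<K$ means that $K$ is a field and $k$ a proper subfield. For a $k$-subspace $W$ of $K$ with $k\cap W=0$, the loop $Q_{k<K}(W)$ is the set $W\times K$ with multiplication $(a,u)(b,v)=(a+b,\;u(1+b)+v(1-a))$, where all operations on the right are those of $K$ (this is a loop, i.e. it has a two-sided identity and all left and right translations are bijections). The triple $k,K,W$, with $k<K$ and $W$ a $k$-subspace of $K$ satisfying $k\cap W=0$, is called tame if $k$ is a prime field, $W$ generates $K$ as a field over $k$, and $K$ is perfect in case $\mathrm{char}(k)=2$. $\mathrm{Aut}(K)$ is the group of all field automorphisms of $K$; maps are written on the right. *)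

theory Defs
  imports "HOL-Algebra.Algebra"
begin

definition proper_subfield :: "'a set \<Rightarrow> ('a, 'b) ring_scheme \<Rightarrow> bool" where
  "proper_subfield k K \<longleftrightarrow> field K \<and> subfield k K \<and> k \<noteq> carrier K"

text \<open>A field viewed as a module over any of its subfields, the scalar action being multiplication.\<close>

definition mult_module :: "('a, 'b) ring_scheme \<Rightarrow> ('a, 'a) module" where
  "mult_module K = \<lparr>carrier = carrier K, monoid.mult = monoid.mult K, monoid.one = monoid.one K,
     ring.zero = ring.zero K, ring.add = ring.add K, smult = monoid.mult K\<rparr>"

definition subspace_over :: "'a set \<Rightarrow> ('a, 'b) ring_scheme \<Rightarrow> 'a set \<Rightarrow> bool" where
  "subspace_over k K W \<longleftrightarrow> submodule W (K\<lparr>carrier := k\<rparr>) (mult_module K)"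

definition prime_field :: "('a, 'b) ring_scheme \<Rightarrow> bool" where
  "prime_field F \<longleftrightarrow> field F \<and> (\<forall>E. subfield E F \<longrightarrow> E = carrier F)"

definition ring_characteristic :: "('a, 'b) ring_scheme \<Rightarrow> nat" where
  "ring_characteristic R =
    (if \<exists>n::nat. n > 0 \<and> add_pow R n \<one>\<^bsub>R\<^esub> = \<zero>\<^bsub>R\<^esub>
     then LEAST n::nat. n > 0 \<and> add_pow R n \<one>\<^bsub>R\<^esub> = \<zero>\<^bsub>R\<^esub> else 0)"

text \<open>Perfect means characteristic zero, or characteristic \<open>p > 0\<close> with surjective
  Frobenius map.\<close>

definition perfect_field :: "('a, 'b) ring_scheme \<Rightarrow> bool" where
  "perfect_field F \<longleftrightarrow> field F \<and>
    (ring_characteristic F = 0 \<or>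
     (\<forall>x\<in>carrier F. \<exists>y\<in>carrier F. y [^]\<^bsub>F\<^esub> ring_characteristic F = x))"

definition tame :: "'a set \<Rightarrow> ('a, 'b) ring_scheme \<Rightarrow> 'a set \<Rightarrow> bool" where
  "tame k K W \<longleftrightarrow>
    proper_subfield k K \<and> subspace_over k K W \<and> k \<inter> W = {\<zero>\<^bsub>K\<^esub>} \<and>
    prime_field (K\<lparr>carrier := k\<rparr>) \<and>
    generate_field K (k \<union> W) = carrier K \<and>
    (ring_characteristic (K\<lparr>carrier := k\<rparr>) = 2 \<longrightarrow> perfect_field K)"

text \<open>The loop \<open>Q\<^bsub>k<K\<^esub>(W)\<close>. Its operation does not mention \<open>k\<close>. The type \<open>monoid\<close> only
  provides the signature: the multiplication need not be associative. The library relation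
  \<open>\<cong>\<close> (existence of a multiplicative bijection between the carriers) is loop isomorphism,
  as such a map automatically preserves the two-sided identity.\<close>

definition loop_Q :: "('a, 'b) ring_scheme \<Rightarrow> 'a set \<Rightarrow> ('a \<times> 'a) monoid" where
  "loop_Q K W = \<lparr>carrier = W \<times> carrier K,
     monoid.mult = (\<lambda>(a, u) (b, v).
       (a \<oplus>\<^bsub>K\<^esub> b,
        u \<otimes>\<^bsub>K\<^esub> (\<one>\<^bsub>K\<^esub> \<oplus>\<^bsub>K\<^esub> b) \<oplus>\<^bsub>K\<^esub> v \<otimes>\<^bsub>K\<^esub> (\<one>\<^bsub>K\<^esub> \<ominus>\<^bsub>K\<^esub> a))),
     monoid.one = (\<zero>\<^bsub>K\<^esub>, \<zero>\<^bsub>K\<^esub>)\<rparr>"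

end

theory Submission
  imports Defs
begin

text \<open>
  An automorphism of the field acts on both coordinates and gives the easy direction. For the other
  one, let \<open>f\<close> be an isomorphism of the loops. The associator of \<open>(a, u), (b, v), (c, w)\<close> is measured
  by \<open>b (u c - w a)\<close>, so the elements that may be put in the middle of any associative law are
  exactly the \<open>(0, v)\<close> (lemma \<open>middle_nucleus_loop_Q\<close>). This set is preserved by \<open>f\<close>, and on it the
  loop operation is addition; hence \<open>f (0, y) = (0, g y)\<close> for an additive bijection \<open>g\<close> of the field.

  Write \<open>f (a, 0) = (h a, s a)\<close>. The product of \<open>(a, 0)\<close>, \<open>(0, y)\<close> and \<open>(-a, 0)\<close> is
  \<open>(0, (1 - a)\<^sup>2 y)\<close>, and applying \<open>f\<close> to it yields \<open>g ((1 - a)\<^sup>2 y) = (1 - h a)\<^sup>2 g y\<close>: conjugation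
  by \<open>g\<close> turns multiplication by the scalar \<open>(1 - a)\<^sup>2\<close> into multiplication by another scalar
  (lemma \<open>loop_Q_iso_intertwines\<close>). The scalars with this property form a subfield, on which the
  passage to the new scalar is the ring homomorphism \<open>\<phi> c = g c / g 1\<close>.

  Tameness makes this subfield everything (lemma \<open>tame_generated_by_squares\<close>). For \<open>a\<close> in the first
  subspace \<open>W\<^sub>0\<close> it contains \<open>4 a = (1 + a)\<^sup>2 - (1 - a)\<^sup>2\<close>, hence \<open>a\<close>, unless the characteristic
  is two. In characteristic two it contains \<open>a\<^sup>2 = (1 + a)\<^sup>2 - 1\<close>; as squaring is then additive, it
  contains the square of every element of the field, and the field is perfect. So \<open>\<phi>\<close> is an
  automorphism with \<open>(1 - \<phi> a)\<^sup>2 = (1 - h a)\<^sup>2\<close> for all \<open>a\<close> in \<open>W\<^sub>0\<close>, and comparing this for \<open>a\<close> and \<open>-a\<close> shows that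
  \<open>\<phi>\<close> agrees with \<open>h\<close>, which maps \<open>W\<^sub>0\<close> onto \<open>W\<^sub>1\<close>.
\<close>

section \<open>The middle nucleus\<close>

definition middle_nucleus :: "('a, 'b) monoid_scheme \<Rightarrow> 'a set" where
  "middle_nucleus G = {x \<in> carrier G. \<forall>p\<in>carrier G. \<forall>q\<in>carrier G.
     (p \<otimes>\<^bsub>G\<^esub> x) \<otimes>\<^bsub>G\<^esub> q = p \<otimes>\<^bsub>G\<^esub> (x \<otimes>\<^bsub>G\<^esub> q)}"

lemma middle_nucleus_iso_image:
  assumes f: "f \<in> iso G H"
    and closed: "\<And>x y. x \<in> carrier G \<Longrightarrow> y \<in> carrier G \<Longrightarrow> x \<otimes>\<^bsub>G\<^esub> y \<in> carrier G"
  shows "f ` middle_nucleus G = middle_nucleus H"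
proof -
  have f_mult: "f (x \<otimes>\<^bsub>G\<^esub> y) = f x \<otimes>\<^bsub>H\<^esub> f y" if "x \<in> carrier G" "y \<in> carrier G" for x y
    using f that by (simp add: iso_def hom_mult)
  have inj: "inj_on f (carrier G)" and img: "f ` carrier G = carrier H"
    using f by (auto simp: iso_def bij_betw_def)
  have mem_iff: "f x \<in> middle_nucleus H \<longleftrightarrow> x \<in> middle_nucleus G" if x: "x \<in> carrier G" for x
  proof -
    have "f x \<in> middle_nucleus H \<longleftrightarrow>
        (\<forall>p\<in>carrier G. \<forall>q\<in>carrier G. (f p \<otimes>\<^bsub>H\<^esub> f x) \<otimes>\<^bsub>H\<^esub> f q = f p \<otimes>\<^bsub>H\<^esub> (f x \<otimes>\<^bsub>H\<^esub> f q))"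
      using x unfolding middle_nucleus_def img[symmetric] by simp
    also have "\<dots> \<longleftrightarrow> (\<forall>p\<in>carrier G. \<forall>q\<in>carrier G.
        f ((p \<otimes>\<^bsub>G\<^esub> x) \<otimes>\<^bsub>G\<^esub> q) = f (p \<otimes>\<^bsub>G\<^esub> (x \<otimes>\<^bsub>G\<^esub> q)))"
      using x by (simp add: f_mult closed)
    also have "\<dots> \<longleftrightarrow> x \<in> middle_nucleus G"
      using x by (simp add: middle_nucleus_def inj_on_eq_iff[OF inj] closed)
    finally show ?thesis .
  qed
  have "middle_nucleus G \<subseteq> carrier G" "middle_nucleus H \<subseteq> f ` carrier G"
    unfolding img by (auto simp: middle_nucleus_def)
  then show ?thesis
    using mem_iff by blast
qed

section \<open>Intertwined scalars\<close>

context field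
begin

text \<open>Conjugation by \<open>g\<close> carries multiplication by \<open>c\<close> to multiplication by \<open>d\<close>. A relation rather
  than a function of \<open>c\<close>, because it is derived for particular pairs first and only later known to
  determine \<open>d\<close> from \<open>c\<close>.\<close>

definition intertwines :: "('a \<Rightarrow> 'a) \<Rightarrow> 'a \<Rightarrow> 'a \<Rightarrow> bool" where
  "intertwines g c d \<longleftrightarrow> c \<in> carrier R \<and> d \<in> carrier R \<and>
     (\<forall>y\<in>carrier R. g (c \<otimes> y) = d \<otimes> g y)"

end

locale field_additive_bij = field R for R (structure) +
  fixes g :: "'a \<Rightarrow> 'a"
  assumes bij: "bij_betw g (carrier R) (carrier R)"
    and add: "\<lbrakk>x \<in> carrier R; y \<in> carrier R\<rbrakk> \<Longrightarrow> g (x \<oplus> y) = g x \<oplus> g y"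
begin

lemma closed [simp]: "x \<in> carrier R \<Longrightarrow> g x \<in> carrier R"
  using bij bij_betwE by blast

lemma zero [simp]: "g \<zero> = \<zero>"
  by (metis add closed l_zero zero_closed add.r_cancel)

lemma neg: "x \<in> carrier R \<Longrightarrow> g (\<ominus> x) = \<ominus> g x"
  by (metis a_inv_closed add closed minus_equality l_neg zero)

lemma inj: "\<lbrakk>x \<in> carrier R; y \<in> carrier R\<rbrakk> \<Longrightarrow> g x = g y \<longleftrightarrow> x = y"
  using bij by (meson bij_betw_def inj_on_eq_iff)

lemma one_nonzero: "g \<one> \<noteq> \<zero>"
  using inj[of \<one> \<zero>] by auto

lemma intertwines_imp_quotient:
  assumes "intertwines g c d"
  shows "d = g c \<otimes> inv (g \<one>)"
proof -
  have "c \<in> carrier R" "d \<in> carrier R" "g c = d \<otimes> g \<one>"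
    using assms unfolding intertwines_def by (auto dest: bspec[of _ _ \<one>])
  then show ?thesis
    using one_nonzero by (simp add: m_assoc field_Units)
qed

lemma intertwines_one: "intertwines g \<one> \<one>"
  by (simp add: intertwines_def)

lemma intertwines_add:
  "\<lbrakk>intertwines g c d; intertwines g c' d'\<rbrakk> \<Longrightarrow> intertwines g (c \<oplus> c') (d \<oplus> d')"
  by (auto simp: intertwines_def add l_distr)

lemma intertwines_neg: "intertwines g c d \<Longrightarrow> intertwines g (\<ominus> c) (\<ominus> d)"
  by (auto simp: intertwines_def neg l_minus)

lemma intertwines_mult:
  "\<lbrakk>intertwines g c d; intertwines g c' d'\<rbrakk> \<Longrightarrow> intertwines g (c \<otimes> c') (d \<otimes> d')"
  by (auto simp: intertwines_def m_assoc)

lemma intertwines_inv: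
  assumes cd: "intertwines g c d" and "c \<noteq> \<zero>"
  shows "intertwines g (inv c) (inv d)"
proof -
  have c: "c \<in> carrier R" and d: "d \<in> carrier R"
    and g: "\<And>y. y \<in> carrier R \<Longrightarrow> g (c \<otimes> y) = d \<otimes> g y"
    using cd by (auto simp: intertwines_def)
  have cU: "c \<in> Units R"
    using c assms(2) by (simp add: field_Units)
  have "d \<noteq> \<zero>"
  proof
    assume "d = \<zero>"
    then have "g (c \<otimes> inv c) = \<zero>"
      using g[of "inv c"] cU by simp
    then show False
      using cU one_nonzero by simp
  qed
  then have dU: "d \<in> Units R"
    using d by (simp add: field_Units)
  have "g (inv c \<otimes> y) = inv d \<otimes> g y" if y: "y \<in> carrier R" for y
  proof -
    have "d \<otimes> g (inv c \<otimes> y) = g (c \<otimes> (inv c \<otimes> y))"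
      using g[of "inv c \<otimes> y"] cU y by simp
    also have "\<dots> = g y"
      using cU c y by (simp add: m_assoc[symmetric])
    finally have "inv d \<otimes> g y = inv d \<otimes> (d \<otimes> g (inv c \<otimes> y))"
      by simp
    also have "\<dots> = g (inv c \<otimes> y)"
      using dU d cU y by (simp add: m_assoc[symmetric])
    finally show ?thesis ..
  qed
  then show ?thesis
    using cU dU by (simp add: intertwines_def)
qed

text \<open>Conjugation by \<open>g\<close> is a ring automorphism of the additive endomorphisms of the field. The field
  embeds there as its multiplication operators, and these scalars form the intersection of the field
  with the preimage of the field under that automorphism.\<close>

lemma intertwined_subfield: "subfield {c. \<exists>d. intertwines g c d} R"
proof (intro subfieldI' subringI)
  show "{c. \<exists>d. intertwines g c d} \<subseteq> carrier R"
    by (auto simp: intertwines_def)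
qed (auto intro: intertwines_one intertwines_neg intertwines_mult intertwines_add intertwines_inv)

text \<open>Evaluation at \<open>1\<close> forces the automorphism to be \<open>\<phi> c = g c / g 1\<close>. It is a homomorphism because
  intertwined pairs are closed under the ring operations, and a bijection because \<open>g\<close> is one.\<close>

lemma ring_iso_if_all_intertwined:
  assumes all: "\<And>c. c \<in> carrier R \<Longrightarrow> \<exists>d. intertwines g c d"
  obtains \<phi> where "\<phi> \<in> ring_iso R R" and "\<And>c d. intertwines g c d \<Longrightarrow> \<phi> c = d"
proof -
  define \<phi> where "\<phi> c = g c \<otimes> inv (g \<one>)" for c
  have eq: "\<phi> c = d" if "intertwines g c d" for c d
    using intertwines_imp_quotient[OF that] by (simp add: \<phi>_def)
  have \<phi>: "intertwines g c (\<phi> c)" if "c \<in> carrier R" for c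
    using all[OF that] eq by blast
  have U: "g \<one> \<in> Units R"
    using one_nonzero by (simp add: field_Units)
  have "\<phi> \<in> ring_iso R R"
  proof (rule ring_iso_memI)
    show "\<phi> x \<in> carrier R" if "x \<in> carrier R" for x
      using \<phi>[OF that] by (simp add: intertwines_def)
    show "\<phi> (x \<otimes> y) = \<phi> x \<otimes> \<phi> y" if "x \<in> carrier R" "y \<in> carrier R" for x y
      using that by (intro eq intertwines_mult \<phi>)
    show "\<phi> (x \<oplus> y) = \<phi> x \<oplus> \<phi> y" if "x \<in> carrier R" "y \<in> carrier R" for x y
      using that by (intro eq intertwines_add \<phi>)
    show "\<phi> \<one> = \<one>"
      by (intro eq intertwines_one)
    show "bij_betw \<phi> (carrier R) (carrier R)"
    proof (rule bij_betwI')
      fix x y assume "x \<in> carrier R" "y \<in> carrier R"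
      then show "(\<phi> x = \<phi> y) = (x = y)"
        using U by (metis \<phi>_def Units_inv_Units Units_inv_closed closed inj m_comm Units_l_cancel)
    next
      fix z assume z: "z \<in> carrier R"
      then obtain x where "x \<in> carrier R" "g x = z \<otimes> g \<one>"
        using bij U by (metis bij_betw_iff_bijections m_closed Units_closed)
      moreover have "z \<otimes> g \<one> \<otimes> inv (g \<one>) = z"
        using z U by (simp add: m_assoc)
      ultimately show "\<exists>x\<in>carrier R. z = \<phi> x"
        unfolding \<phi>_def by metis
    qed (use U in \<open>simp add: \<phi>_def\<close>)
  qed
  with eq show ?thesis
    using that by blast
qed

end

section \<open>The loops\<close>

lemma carrier_loop_Q [simp]: "carrier (loop_Q R W) = W \<times> carrier R"
  by (simp add: loop_Q_def)

lemma mult_loop_Q [simp]: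
  "(a, u) \<otimes>\<^bsub>loop_Q R W\<^esub> (b, v) = (a \<oplus>\<^bsub>R\<^esub> b,
     u \<otimes>\<^bsub>R\<^esub> (\<one>\<^bsub>R\<^esub> \<oplus>\<^bsub>R\<^esub> b) \<oplus>\<^bsub>R\<^esub> v \<otimes>\<^bsub>R\<^esub> (\<one>\<^bsub>R\<^esub> \<ominus>\<^bsub>R\<^esub> a))"
  by (simp add: loop_Q_def)

text \<open>Since \<open>W\<close> is closed under negation, excluding \<open>1\<close> makes every \<open>1 - a\<close> and \<open>1 + a\<close> with \<open>a \<in> W\<close>
  invertible, which is what division in the loop requires.\<close>

locale loop_Q_field = field R + W: additive_subgroup W R for R (structure) and W +
  assumes one_notin: "\<one> \<notin> W"
begin

lemma W_carrier [simp]: "a \<in> W \<Longrightarrow> a \<in> carrier R"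
  by (rule W.a_Hcarr)

lemma loop_Q_closed:
  "\<lbrakk>p \<in> carrier (loop_Q R W); q \<in> carrier (loop_Q R W)\<rbrakk>
    \<Longrightarrow> p \<otimes>\<^bsub>loop_Q R W\<^esub> q \<in> carrier (loop_Q R W)"
  by (auto simp: W.a_closed)

lemma W_neg: "a \<in> W \<Longrightarrow> \<ominus> a \<in> W"
  using W.a_subgroup by (metis a_inv_def subgroup.m_inv_closed)

text \<open>Expanding both sides, the terms in \<open>v\<close> cancel and the rest is \<open>b (u c - w a)\<close>; that \<open>v\<close>
  disappears is what makes membership of \<open>(b, v)\<close> in the middle nucleus depend on \<open>b\<close> alone.\<close>

lemma associator_loop_Q:
  assumes "a \<in> carrier R" "b \<in> carrier R" "c \<in> carrier R"
    "u \<in> carrier R" "v \<in> carrier R" "w \<in> carrier R"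
  shows "((a, u) \<otimes>\<^bsub>loop_Q R W\<^esub> (b, v)) \<otimes>\<^bsub>loop_Q R W\<^esub> (c, w) =
      (a, u) \<otimes>\<^bsub>loop_Q R W\<^esub> ((b, v) \<otimes>\<^bsub>loop_Q R W\<^esub> (c, w)) \<longleftrightarrow>
    b \<otimes> (u \<otimes> c \<ominus> w \<otimes> a) = \<zero>"
proof -
  let ?l = "(u \<otimes> (\<one> \<oplus> b) \<oplus> v \<otimes> (\<one> \<ominus> a)) \<otimes> (\<one> \<oplus> c) \<oplus> w \<otimes> (\<one> \<ominus> (a \<oplus> b))"
  let ?r = "u \<otimes> (\<one> \<oplus> (b \<oplus> c)) \<oplus> (v \<otimes> (\<one> \<oplus> c) \<oplus> w \<otimes> (\<one> \<ominus> b)) \<otimes> (\<one> \<ominus> a)"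
  have u_part: "u \<otimes> (\<one> \<oplus> b) \<otimes> (\<one> \<oplus> c) = u \<otimes> (\<one> \<oplus> (b \<oplus> c)) \<oplus> b \<otimes> (u \<otimes> c)"
    using assms by algebra
  have v_part: "v \<otimes> (\<one> \<ominus> a) \<otimes> (\<one> \<oplus> c) = v \<otimes> (\<one> \<oplus> c) \<otimes> (\<one> \<ominus> a)"
    using assms by (simp add: m_ac)
  have w_part: "w \<otimes> (\<one> \<ominus> (a \<oplus> b)) = w \<otimes> (\<one> \<ominus> b) \<otimes> (\<one> \<ominus> a) \<oplus> \<ominus> (b \<otimes> (w \<otimes> a))"
    using assms by algebra
  have closed: "?l \<in> carrier R" "?r \<in> carrier R" "b \<otimes> (u \<otimes> c \<ominus> w \<otimes> a) \<in> carrier R"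
    using assms by simp_all
  have "?l = u \<otimes> (\<one> \<oplus> b) \<otimes> (\<one> \<oplus> c) \<oplus> v \<otimes> (\<one> \<ominus> a) \<otimes> (\<one> \<oplus> c) \<oplus> w \<otimes> (\<one> \<ominus> (a \<oplus> b))"
    using assms by (simp add: l_distr)
  also have "\<dots> = ?r \<oplus> (b \<otimes> (u \<otimes> c) \<oplus> \<ominus> (b \<otimes> (w \<otimes> a)))"
    unfolding u_part v_part w_part using assms by (simp add: l_distr a_ac)
  also have "b \<otimes> (u \<otimes> c) \<oplus> \<ominus> (b \<otimes> (w \<otimes> a)) = b \<otimes> (u \<otimes> c \<ominus> w \<otimes> a)"
    using assms by (simp add: minus_eq r_distr r_minus)
  finally have "?l = ?r \<oplus> b \<otimes> (u \<otimes> c \<ominus> w \<otimes> a)" .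
  then have "?l = ?r \<longleftrightarrow> b \<otimes> (u \<otimes> c \<ominus> w \<otimes> a) = \<zero>"
    using closed by simp
  then show ?thesis
    using assms by (simp add: a_assoc)
qed

text \<open>If \<open>(b, v)\<close> lies in the middle nucleus, the associator condition for the outer factors \<open>(0, 1)\<close>
  and \<open>(b, 0)\<close> reads \<open>b b = 0\<close>.\<close>

lemma middle_nucleus_loop_Q:
  "middle_nucleus (loop_Q R W) = {\<zero>} \<times> carrier R"
proof (intro equalityI subsetI)
  fix x assume x: "x \<in> middle_nucleus (loop_Q R W)"
  obtain b v where bv: "x = (b, v)" "b \<in> W" "v \<in> carrier R"
    using x by (auto simp: middle_nucleus_def)
  have "((\<zero>, \<one>) \<otimes>\<^bsub>loop_Q R W\<^esub> (b, v)) \<otimes>\<^bsub>loop_Q R W\<^esub> (b, \<zero>) =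
      (\<zero>, \<one>) \<otimes>\<^bsub>loop_Q R W\<^esub> ((b, v) \<otimes>\<^bsub>loop_Q R W\<^esub> (b, \<zero>))"
    using x W.zero_closed bv(1,2) by (simp add: middle_nucleus_def del: mult_loop_Q)
  then have "b \<otimes> (\<one> \<otimes> b \<ominus> \<zero> \<otimes> \<zero>) = \<zero>"
    using associator_loop_Q[of \<zero> b b \<one> v \<zero>] bv by (simp del: mult_loop_Q)
  then have "b \<otimes> b = \<zero>"
    using bv(2) by (simp add: a_minus_def)
  then have "b = \<zero>"
    using bv by (simp add: integral_iff)
  then show "x \<in> {\<zero>} \<times> carrier R"
    using bv by simp
next
  fix x assume "x \<in> {\<zero>} \<times> carrier R"
  then obtain v where v: "x = (\<zero>, v)" "v \<in> carrier R"
    by auto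
  then have "(p \<otimes>\<^bsub>loop_Q R W\<^esub> x) \<otimes>\<^bsub>loop_Q R W\<^esub> q = p \<otimes>\<^bsub>loop_Q R W\<^esub> (x \<otimes>\<^bsub>loop_Q R W\<^esub> q)"
    if "p \<in> W \<times> carrier R" "q \<in> W \<times> carrier R" for p q
    using that v by (cases p; cases q) (simp add: associator_loop_Q del: mult_loop_Q)
  then show "x \<in> middle_nucleus (loop_Q R W)"
    using v W.zero_closed by (simp add: middle_nucleus_def del: mult_loop_Q)
qed

end

text \<open>Surrounding an element of the middle nucleus by \<open>(a, _)\<close> and \<open>(-a, _)\<close> leads back into the middle
  nucleus. The result depends on \<open>y\<close> only through the scalar \<open>(1 - a)\<^sup>2\<close>; the remaining summand is
  a constant. The values \<open>s\<close> and \<open>t\<close> are arbitrary because the image of \<open>(a, 0)\<close> under an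
  isomorphism need not have second coordinate zero.\<close>

lemma (in loop_Q_field) loop_Q_sandwich:
  assumes "a \<in> W" and [simp]: "s \<in> carrier R" "t \<in> carrier R" "y \<in> carrier R"
  shows "((a, s) \<otimes>\<^bsub>loop_Q R W\<^esub> (\<zero>, y)) \<otimes>\<^bsub>loop_Q R W\<^esub> (\<ominus> a, t) =
    (\<zero>, (\<one> \<ominus> a) \<otimes> (\<one> \<ominus> a) \<otimes> y \<oplus> (s \<oplus> t) \<otimes> (\<one> \<ominus> a))"
proof -
  have a [simp]: "a \<in> carrier R"
    using assms(1) by simp
  have "(s \<otimes> (\<one> \<oplus> \<zero>) \<oplus> y \<otimes> (\<one> \<ominus> a)) \<otimes> (\<one> \<oplus> \<ominus> a) \<oplus> t \<otimes> (\<one> \<ominus> (a \<oplus> \<zero>)) =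
      (\<one> \<ominus> a) \<otimes> (\<one> \<ominus> a) \<otimes> y \<oplus> (s \<oplus> t) \<otimes> (\<one> \<ominus> a)"
    using assms(2-) a by algebra
  then show ?thesis
    by (simp add: r_neg)
qed

text \<open>Here \<open>g\<close> is the restriction of \<open>f\<close> to the middle nucleus and \<open>h\<close> the map that \<open>f\<close> induces modulo
  it. The square of \<open>1 - a\<close> appears by applying \<open>f\<close> to the sandwich identity; the constant summand
  on the right is seen to vanish at \<open>y = 0\<close>.\<close>

lemma (in field) loop_Q_iso_intertwines:
  assumes "loop_Q_field R W\<^sub>0" "loop_Q_field R W\<^sub>1"
    and f: "f \<in> iso (loop_Q R W\<^sub>0) (loop_Q R W\<^sub>1)"
  obtains g h where "field_additive_bij R g" and "h ` W\<^sub>0 = W\<^sub>1"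
    and "\<And>a. a \<in> W\<^sub>0 \<Longrightarrow> h (\<ominus> a) = \<ominus> h a"
    and "\<And>a. a \<in> W\<^sub>0 \<Longrightarrow>
      intertwines g ((\<one> \<ominus> a) \<otimes> (\<one> \<ominus> a)) ((\<one> \<ominus> h a) \<otimes> (\<one> \<ominus> h a))"
proof -
  interpret W0: loop_Q_field R W\<^sub>0 by fact
  interpret W1: loop_Q_field R W\<^sub>1 by fact
  have f_mult: "f (p \<otimes>\<^bsub>loop_Q R W\<^sub>0\<^esub> q) = f p \<otimes>\<^bsub>loop_Q R W\<^sub>1\<^esub> f q"
    if "p \<in> W\<^sub>0 \<times> carrier R" "q \<in> W\<^sub>0 \<times> carrier R" for p q
    using f that by (simp add: iso_def hom_mult)
  have bij_f: "bij_betw f (W\<^sub>0 \<times> carrier R) (W\<^sub>1 \<times> carrier R)"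
    using f by (simp add: iso_def)
  have nucleus: "f ` ({\<zero>} \<times> carrier R) = {\<zero>} \<times> carrier R"
    using middle_nucleus_iso_image[OF f W0.loop_Q_closed]
    by (simp add: W0.middle_nucleus_loop_Q W1.middle_nucleus_loop_Q)
  define g where "g y = snd (f (\<zero>, y))" for y
  define h where "h a = fst (f (a, \<zero>))" for a
  define s where "s a = snd (f (a, \<zero>))" for a
  have f_g: "f (\<zero>, y) = (\<zero>, g y)" and g_closed: "g y \<in> carrier R" if "y \<in> carrier R" for y
  proof -
    have "f (\<zero>, y) \<in> {\<zero>} \<times> carrier R"
      using nucleus that by blast
    then show "f (\<zero>, y) = (\<zero>, g y)" "g y \<in> carrier R"
      by (auto simp: g_def)
  qed
  have f_h: "f (a, \<zero>) = (h a, s a)" for a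
    by (simp add: h_def s_def)
  have h_in: "h a \<in> W\<^sub>1" and s_closed: "s a \<in> carrier R" if "a \<in> W\<^sub>0" for a
    using bij_betw_apply[OF bij_f, of "(a, \<zero>)"] that by (auto simp: f_h)

  interpret g: field_additive_bij R g
  proof
    have inj_f: "inj_on f (W\<^sub>0 \<times> carrier R)"
      using bij_f by (rule bij_betw_imp_inj_on)
    have "inj_on g (carrier R)"
    proof (rule inj_onI)
      fix x y assume "x \<in> carrier R" "y \<in> carrier R" "g x = g y"
      then show "x = y"
        using inj_onD[OF inj_f, of "(\<zero>, x)" "(\<zero>, y)"] W0.W.zero_closed by (simp add: f_g)
    qed
    moreover have "z \<in> g ` carrier R" if "z \<in> carrier R" for z
    proof -
      have "(\<zero>, z) \<in> f ` ({\<zero>} \<times> carrier R)"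
        using nucleus that by simp
      then show ?thesis
        by (auto simp: f_g)
    qed
    ultimately show "bij_betw g (carrier R) (carrier R)"
      using g_closed by (auto simp: bij_betw_def)
    show "g (x \<oplus> y) = g x \<oplus> g y" if "x \<in> carrier R" "y \<in> carrier R" for x y
      using f_mult[of "(\<zero>, x)" "(\<zero>, y)"] that W0.W.zero_closed
      by (simp add: f_g g_closed a_minus_def)
  qed

  have h_neg: "h (\<ominus> a) = \<ominus> h a" if a: "a \<in> W\<^sub>0" for a
  proof -
    have "f (\<zero>, \<zero>) = f (a, \<zero>) \<otimes>\<^bsub>loop_Q R W\<^sub>1\<^esub> f (\<ominus> a, \<zero>)"
      using f_mult[of "(a, \<zero>)" "(\<ominus> a, \<zero>)"] a W0.W_neg[OF a] by (simp add: r_neg)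
    then have "h a \<oplus> h (\<ominus> a) = \<zero>"
      by (simp add: f_g f_h[of a] f_h[of "\<ominus> a"])
    then show ?thesis
      using h_in[OF a] h_in[OF W0.W_neg[OF a]] by (metis W1.W_carrier a_comm minus_equality)
  qed

  have "h ` W\<^sub>0 = W\<^sub>1"
  proof (intro equalityI subsetI)
    fix b assume "b \<in> W\<^sub>1"
    then have "(b, \<zero>) \<in> f ` (W\<^sub>0 \<times> carrier R)"
      using bij_f by (simp add: bij_betw_def)
    then obtain a u where au: "a \<in> W\<^sub>0" "u \<in> carrier R" "f (a, u) = (b, \<zero>)"
      by auto
    \<comment> \<open>The element \<open>y\<close> solves \<open>(a, 0) (0, y) = (a, u)\<close>, so \<open>f (a, u)\<close> and \<open>f (a, 0)\<close> have the same
      first coordinate.\<close>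
    define y where "y = u \<otimes> inv (\<one> \<ominus> a)"
    have U: "\<one> \<ominus> a \<in> Units R"
      using au(1) W0.one_notin by (auto simp: field_Units)
    then have y: "y \<in> carrier R" "y \<otimes> (\<one> \<ominus> a) = u"
      using au by (auto simp: y_def m_assoc)
    have "f (a, u) = f (a, \<zero>) \<otimes>\<^bsub>loop_Q R W\<^sub>1\<^esub> f (\<zero>, y)"
      using f_mult[of "(a, \<zero>)" "(\<zero>, y)"] au(1,2) y W0.W.zero_closed by simp
    then have "fst (f (a, u)) = fst (f (a, \<zero>) \<otimes>\<^bsub>loop_Q R W\<^sub>1\<^esub> f (\<zero>, y))"
      by (rule arg_cong)
    then have "b = h a"
      using au h_in[OF au(1)] by (simp add: f_h f_g[OF y(1)])
    then show "b \<in> h ` W\<^sub>0"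
      using au(1) by simp
  qed (use h_in in auto)

  moreover have "intertwines g ((\<one> \<ominus> a) \<otimes> (\<one> \<ominus> a)) ((\<one> \<ominus> h a) \<otimes> (\<one> \<ominus> h a))"
    if a: "a \<in> W\<^sub>0" for a
  proof -
    let ?d = "(s a \<oplus> s (\<ominus> a)) \<otimes> (\<one> \<ominus> h a)"
    have closed: "h a \<in> carrier R" "s a \<in> carrier R" "s (\<ominus> a) \<in> carrier R"
      using h_in s_closed a W0.W_neg[OF a] by auto
    have sandwich: "g ((\<one> \<ominus> a) \<otimes> (\<one> \<ominus> a) \<otimes> y) = (\<one> \<ominus> h a) \<otimes> (\<one> \<ominus> h a) \<otimes> g y \<oplus> ?d"
      if y: "y \<in> carrier R" for y
    proof -
      let ?p = "(a, \<zero>)" and ?x = "(\<zero>, y)" and ?q = "(\<ominus> a, \<zero>)"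
      have in0: "?p \<in> W\<^sub>0 \<times> carrier R" "?x \<in> W\<^sub>0 \<times> carrier R" "?q \<in> W\<^sub>0 \<times> carrier R"
        using a y W0.W_neg[OF a] W0.W.zero_closed by auto
      then have "?p \<otimes>\<^bsub>loop_Q R W\<^sub>0\<^esub> ?x \<in> W\<^sub>0 \<times> carrier R"
        using W0.loop_Q_closed[of ?p ?x] by simp
      then have "f ((?p \<otimes>\<^bsub>loop_Q R W\<^sub>0\<^esub> ?x) \<otimes>\<^bsub>loop_Q R W\<^sub>0\<^esub> ?q) =
          (f ?p \<otimes>\<^bsub>loop_Q R W\<^sub>1\<^esub> f ?x) \<otimes>\<^bsub>loop_Q R W\<^sub>1\<^esub> f ?q"
        using in0 f_mult by (simp del: mult_loop_Q)
      then show ?thesis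
        using a y closed h_in[OF a] g_closed[OF y]
        by (simp add: W0.loop_Q_sandwich W1.loop_Q_sandwich f_h f_g h_neg del: mult_loop_Q)
    qed
    from sandwich[of \<zero>] have "?d = \<zero>"
      using a closed by simp
    then show ?thesis
      using sandwich a closed by (simp add: intertwines_def)
  qed
  ultimately show ?thesis
    using that g.field_additive_bij_axioms h_neg by blast
qed

lemma (in field) loop_Q_iso_if_ring_iso:
  assumes "\<phi> \<in> ring_iso R R" and "W\<^sub>0 \<subseteq> carrier R" and "\<phi> ` W\<^sub>0 = W\<^sub>1"
  shows "loop_Q R W\<^sub>0 \<cong> loop_Q R W\<^sub>1"
proof -
  have hom: "\<phi> \<in> ring_hom R R" and bij: "bij_betw \<phi> (carrier R) (carrier R)"
    using assms(1) by (auto simp: ring_iso_def)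
  interpret \<phi>: ring_hom_cring R R \<phi>
    using hom by unfold_locales
  let ?f = "map_prod \<phi> \<phi>"
  have "bij_betw \<phi> W\<^sub>0 W\<^sub>1"
    using assms(2,3) bij by (meson bij_betw_subset)
  then have "bij_betw ?f (W\<^sub>0 \<times> carrier R) (W\<^sub>1 \<times> carrier R)"
    using bij by (rule bij_betw_map_prod)
  moreover have "?f \<in> hom (loop_Q R W\<^sub>0) (loop_Q R W\<^sub>1)"
    using assms(2,3) by (auto simp: hom_def a_minus_def subset_iff)
  ultimately have "?f \<in> iso (loop_Q R W\<^sub>0) (loop_Q R W\<^sub>1)"
    by (simp add: iso_def)
  then show ?thesis
    by (rule is_isoI)
qed


section \<open>Tame triples\<close>

lemma (in field) ring_characteristic_eq_2:
  assumes "\<one> \<oplus> \<one> = \<zero>"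
  shows "ring_characteristic R = 2"
proof -
  have two: "(2::nat) > 0 \<and> add_pow R (2::nat) \<one> = \<zero>"
    using assms by (simp add: numeral_2_eq_2)
  have "(LEAST n::nat. n > 0 \<and> add_pow R n \<one> = \<zero>) = 2"
  proof (rule Least_equality)
    show "2 \<le> n" if "0 < n \<and> add_pow R n \<one> = \<zero>" for n :: nat
      using that by (cases "n = 1") auto
  qed (rule two)
  moreover have "\<exists>n::nat. n > 0 \<and> add_pow R n \<one> = \<zero>"
    using two by blast
  ultimately show ?thesis
    by (simp add: ring_characteristic_def)
qed

lemma (in field) prime_subfield_subset:
  assumes k: "subfield k R" "prime_field (R\<lparr>carrier := k\<rparr>)" and E: "subfield E R"
  shows "k \<subseteq> E"
proof -
  have "subfield (k \<inter> E) R"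
  proof (rule subfieldI')
    show "subring (k \<inter> E) R"
      using k E by (intro subring_inter subfieldE(1))
    show "inv x \<in> k \<inter> E" if "x \<in> k \<inter> E - {\<zero>}" for x
      using that subfield_m_inv(1)[OF k(1)] subfield_m_inv(1)[OF E] by blast
  qed
  then have inter: "field (R\<lparr>carrier := k \<inter> E\<rparr>)"
    by (rule subfield_iff(2))
  interpret k: field "R\<lparr>carrier := k\<rparr>"
    using k(1) by (rule subfield_iff(2))
  have "subfield (k \<inter> E) (R\<lparr>carrier := k\<rparr>)"
    using inter by (intro k.subfield_iff(1)) auto
  then show ?thesis
    using k(2) by (auto simp: prime_field_def)
qed

lemma subspace_over_additive_subgroup:
  assumes "subspace_over k K W"
  shows "additive_subgroup W K"
proof -
  interpret submodule W "K\<lparr>carrier := k\<rparr>" "mult_module K"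
    using assms by (simp add: subspace_over_def)
  have "subgroup W (add_monoid K)"
  proof (rule subgroup.intro)
    show "inv\<^bsub>add_monoid K\<^esub> x \<in> W" if "x \<in> W" for x
      using m_inv_closed[OF that] by (simp add: m_inv_def mult_module_def)
  qed (use subset m_closed one_closed in \<open>auto simp: mult_module_def\<close>)
  then show ?thesis
    by (rule additive_subgroupI)
qed

text \<open>A common element \<open>1\<close> of \<open>k\<close> and \<open>W\<close> is excluded by \<open>k \<inter> W = 0\<close>.\<close>

lemma tame_loop_Q_field:
  assumes "tame k K W"
  shows "loop_Q_field K W"
proof -
  interpret field K
    using assms by (simp add: tame_def proper_subfield_def)
  have "subfield k K" "subspace_over k K W" "k \<inter> W = {\<zero>\<^bsub>K\<^esub>}"
    using assms by (auto simp: tame_def proper_subfield_def)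
  moreover have "\<one>\<^bsub>K\<^esub> \<in> k"
    using calculation(1) by (intro subringE(3) subfieldE(1))
  ultimately have "\<one>\<^bsub>K\<^esub> \<notin> W" "additive_subgroup W K"
    using one_not_zero subspace_over_additive_subgroup by blast+
  then show ?thesis
    using field_axioms by (auto simp: loop_Q_field_def loop_Q_field_axioms_def)
qed

lemma (in cring) square_diff_eq_four_mult:
  assumes "x \<in> carrier R"
  shows "(\<one> \<oplus> x) \<otimes> (\<one> \<oplus> x) \<ominus> (\<one> \<ominus> x) \<otimes> (\<one> \<ominus> x) = (\<one> \<oplus> \<one>) \<otimes> (\<one> \<oplus> \<one>) \<otimes> x"
  using assms by algebra

lemma (in cring) square_add_char_2:
  assumes "\<one> \<oplus> \<one> = \<zero>" and xy: "x \<in> carrier R" "y \<in> carrier R"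
  shows "(x \<oplus> y) \<otimes> (x \<oplus> y) = x \<otimes> x \<oplus> y \<otimes> y"
proof -
  have "(x \<oplus> y) \<otimes> (x \<oplus> y) = (x \<otimes> x \<oplus> y \<otimes> y) \<oplus> (\<one> \<oplus> \<one>) \<otimes> (x \<otimes> y)"
    using xy by algebra
  then show ?thesis
    using assms by simp
qed

text \<open>The preimage of a subfield under the Frobenius endomorphism; additivity of squaring is where
  characteristic two enters.\<close>

lemma (in field) sqrt_subfield:
  assumes E: "subfield E R" and char2: "\<one> \<oplus> \<one> = \<zero>"
  shows "subfield {x \<in> carrier R. x \<otimes> x \<in> E} R"
proof (intro subfieldI' subringI)
  note E_closed = subringE[OF subfieldE(1)[OF E]]
  show "x \<oplus> y \<in> {x \<in> carrier R. x \<otimes> x \<in> E}"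
    if "x \<in> {x \<in> carrier R. x \<otimes> x \<in> E}" "y \<in> {x \<in> carrier R. x \<otimes> x \<in> E}" for x y
  proof -
    have "(x \<oplus> y) \<otimes> (x \<oplus> y) = x \<otimes> x \<oplus> y \<otimes> y"
      using that by (intro square_add_char_2 char2) auto
    then show ?thesis
      using that E_closed(7) by auto
  qed
  show "\<ominus> x \<in> {x \<in> carrier R. x \<otimes> x \<in> E}" if "x \<in> {x \<in> carrier R. x \<otimes> x \<in> E}" for x
    using that by (auto simp: l_minus r_minus)
  show "x \<otimes> y \<in> {x \<in> carrier R. x \<otimes> x \<in> E}"
    if "x \<in> {x \<in> carrier R. x \<otimes> x \<in> E}" "y \<in> {x \<in> carrier R. x \<otimes> x \<in> E}" for x y
  proof -
    have "x \<otimes> y \<otimes> (x \<otimes> y) = x \<otimes> x \<otimes> (y \<otimes> y)"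
      using that by (simp add: m_ac)
    then show ?thesis
      using that E_closed(6) by auto
  qed
  show "inv x \<in> {x \<in> carrier R. x \<otimes> x \<in> E}"
    if "x \<in> {x \<in> carrier R. x \<otimes> x \<in> E} - {\<zero>}" for x
  proof -
    have x: "x \<in> Units R" "x \<otimes> x \<in> E - {\<zero>}" and xR: "x \<in> carrier R"
      using that by (auto simp: field_Units integral_iff)
    then have "inv (x \<otimes> x) \<in> E"
      using subfield_m_inv(1)[OF E] by blast
    moreover have "inv (x \<otimes> x) = inv x \<otimes> inv x"
    proof (rule comm_inv_char)
      have "x \<otimes> (inv x \<otimes> inv x) = inv x"
        using x(1) xR by (simp add: m_assoc[symmetric])
      then show "x \<otimes> x \<otimes> (inv x \<otimes> inv x) = \<one>"
        using x(1) xR by (simp add: m_assoc)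
    qed (use x(1) xR in auto)
    ultimately show ?thesis
      using x(1) by simp
  qed
qed (use subringE[OF subfieldE(1)[OF E]] in auto)


text \<open>In characteristic other than two, \<open>(1 + a)\<^sup>2 - (1 - a)\<^sup>2 = 4 a\<close> with \<open>4\<close> invertible recovers
  \<open>a\<close>. In characteristic two, the elements whose square is in \<open>E\<close> form a subfield containing \<open>W\<close>, hence
  everything; so \<open>E\<close> contains all squares, and perfectness makes every element a square.
  The prime field \<open>k\<close> lies in every subfield.\<close>

lemma tame_generated_by_squares:
  fixes K (structure)
  assumes tame: "tame k K W" and E: "subfield E K"
    and squares: "\<And>a. a \<in> W \<Longrightarrow> (\<one> \<ominus> a) \<otimes> (\<one> \<ominus> a) \<in> E"
  shows "E = carrier K"
proof -
  interpret loop_Q_field K W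
    using tame by (rule tame_loop_Q_field)
  have k: "subfield k K" "prime_field (K\<lparr>carrier := k\<rparr>)"
    and gen: "generate_field K (k \<union> W) = carrier K"
    and perfect: "ring_characteristic (K\<lparr>carrier := k\<rparr>) = 2 \<Longrightarrow> perfect_field K"
    using tame by (auto simp: tame_def proper_subfield_def)
  note E_closed = subringE[OF subfieldE(1)[OF E]]
  have full: "F = carrier K" if "subfield F K" "W \<subseteq> F" for F
    using generate_field_min_subfield1[of "k \<union> W" F] that gen subfieldE(3)[OF that(1)]
      subfieldE(3)[OF k(1)] prime_subfield_subset[OF k that(1)] by auto
  have squares': "(\<one> \<oplus> a) \<otimes> (\<one> \<oplus> a) \<in> E" if "a \<in> W" for a
    using squares[OF W_neg[OF that]] that by (simp add: a_minus_def)
  show ?thesis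
  proof (cases "\<one> \<oplus> \<one> = \<zero>")
    case False
    define t where "t = (\<one> \<oplus> \<one>) \<otimes> (\<one> \<oplus> \<one>)"
    have t: "t \<in> E" "t \<in> carrier K" "t \<noteq> \<zero>"
      using False E_closed by (auto simp: t_def integral_iff)
    have tU: "t \<in> Units K"
      using t by (simp add: field_Units)
    have "a \<in> E" if a: "a \<in> W" for a
    proof -
      have aK: "a \<in> carrier K"
        using a by simp
      have "t \<otimes> a = (\<one> \<oplus> a) \<otimes> (\<one> \<oplus> a) \<ominus> (\<one> \<ominus> a) \<otimes> (\<one> \<ominus> a)"
        unfolding t_def by (rule square_diff_eq_four_mult[OF aK, symmetric])
      then have "t \<otimes> a \<in> E"
        using squares[OF a] squares'[OF a] E_closed(5,7) by (simp add: minus_eq)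
      moreover have "inv t \<in> E"
        using subfield_m_inv(1)[OF E] t by blast
      ultimately have "inv t \<otimes> (t \<otimes> a) \<in> E"
        using E_closed(6) by blast
      moreover have "inv t \<otimes> (t \<otimes> a) = a"
        using tU t(2) aK by (simp add: m_assoc[symmetric])
      ultimately show ?thesis
        by simp
    qed
    then show ?thesis
      using full[OF E] by blast
  next
    case True
    have "ring_characteristic (K\<lparr>carrier := k\<rparr>) = 2"
      using field.ring_characteristic_eq_2[OF subfield_iff(2)[OF k(1)]] True by simp
    then have "perfect_field K"
      by (rule perfect)
    then have sqrt: "\<exists>x\<in>carrier K. x \<otimes> x = y" if "y \<in> carrier K" for y
      using that by (simp add: perfect_field_def ring_characteristic_eq_2[OF True] numeral_2_eq_2)
    have "W \<subseteq> {x \<in> carrier K. x \<otimes> x \<in> E}"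
    proof
      fix a assume a: "a \<in> W"
      then have aK: "a \<in> carrier K"
        by simp
      then have "(\<one> \<oplus> a) \<otimes> (\<one> \<oplus> a) = \<one> \<oplus> a \<otimes> a"
        using square_add_char_2[OF True one_closed] by simp
      then have "a \<otimes> a = \<ominus> \<one> \<oplus> (\<one> \<oplus> a) \<otimes> (\<one> \<oplus> a)"
        using aK by (simp add: r_neg1)
      then show "a \<in> {x \<in> carrier K. x \<otimes> x \<in> E}"
        using aK squares'[OF a] E_closed(3,5,7) by simp
    qed
    then have "{x \<in> carrier K. x \<otimes> x \<in> E} = carrier K"
      by (intro full sqrt_subfield E True)
    then show ?thesis
      using sqrt E_closed(1) by blast
  qed
qed

text \<open>Subtracting one equation from the other gives \<open>4 x = 4 y\<close>, which settles every characteristic but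
  two. In characteristic two each equation reduces to \<open>x\<^sup>2 = y\<^sup>2\<close>, and \<open>(x - y)\<^sup>2 = x\<^sup>2 - y\<^sup>2\<close>.\<close>

lemma (in field) eq_if_squares_eq:
  assumes x: "x \<in> carrier R" and y: "y \<in> carrier R"
    and minus: "(\<one> \<ominus> x) \<otimes> (\<one> \<ominus> x) = (\<one> \<ominus> y) \<otimes> (\<one> \<ominus> y)"
    and plus: "(\<one> \<oplus> x) \<otimes> (\<one> \<oplus> x) = (\<one> \<oplus> y) \<otimes> (\<one> \<oplus> y)"
  shows "x = y"
proof (cases "\<one> \<oplus> \<one> = \<zero>")
  case True
  have "x \<otimes> x = y \<otimes> y"
    using plus x y by (simp add: square_add_char_2[OF True])
  moreover have "(x \<ominus> y) \<otimes> (x \<ominus> y) = x \<otimes> x \<oplus> \<ominus> y \<otimes> \<ominus> y"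
    unfolding minus_eq using x y by (intro square_add_char_2[OF True]) auto
  ultimately have "(x \<ominus> y) \<otimes> (x \<ominus> y) = (\<one> \<oplus> \<one>) \<otimes> (y \<otimes> y)"
    using x y by (simp add: l_minus r_minus l_distr)
  then have "(x \<ominus> y) \<otimes> (x \<ominus> y) = \<zero>"
    using y True by simp
  then show ?thesis
    using x y by (simp add: integral_iff)
next
  case False
  have "(\<one> \<oplus> \<one>) \<otimes> (\<one> \<oplus> \<one>) \<otimes> x = (\<one> \<oplus> \<one>) \<otimes> (\<one> \<oplus> \<one>) \<otimes> y"
    unfolding square_diff_eq_four_mult[OF x, symmetric] square_diff_eq_four_mult[OF y, symmetric]
      minus plus ..
  then show ?thesis
    using x y False by (simp add: m_lcancel integral_iff)
qed

theorem corollary3p3: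
  fixes K :: "('a, 'b) ring_scheme" and k W\<^sub>0 W\<^sub>1 :: "'a set"
  assumes "proper_subfield k K"
    and "subspace_over k K W\<^sub>0" and "subspace_over k K W\<^sub>1"
    and "tame k K W\<^sub>0" and "tame k K W\<^sub>1"
  shows "loop_Q K W\<^sub>0 \<cong> loop_Q K W\<^sub>1 \<longleftrightarrow> (\<exists>\<phi>\<in>ring_iso K K. \<phi> ` W\<^sub>0 = W\<^sub>1)"
proof
  interpret W0: loop_Q_field K W\<^sub>0
    using assms(4) by (rule tame_loop_Q_field)
  show "loop_Q K W\<^sub>0 \<cong> loop_Q K W\<^sub>1" if "\<exists>\<phi>\<in>ring_iso K K. \<phi> ` W\<^sub>0 = W\<^sub>1"
    using that W0.loop_Q_iso_if_ring_iso W0.W_carrier by blast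

  interpret W1: loop_Q_field K W\<^sub>1
    using assms(5) by (rule tame_loop_Q_field)
  assume "loop_Q K W\<^sub>0 \<cong> loop_Q K W\<^sub>1"
  then obtain f where "f \<in> iso (loop_Q K W\<^sub>0) (loop_Q K W\<^sub>1)"
    by (auto simp: is_iso_def)
  then obtain g h where g: "field_additive_bij K g" and h_image: "h ` W\<^sub>0 = W\<^sub>1"
    and h_neg: "\<And>a. a \<in> W\<^sub>0 \<Longrightarrow> h (\<ominus>\<^bsub>K\<^esub> a) = \<ominus>\<^bsub>K\<^esub> h a"
    and squares: "\<And>a. a \<in> W\<^sub>0 \<Longrightarrow> W0.intertwines g
      ((\<one>\<^bsub>K\<^esub> \<ominus>\<^bsub>K\<^esub> a) \<otimes>\<^bsub>K\<^esub> (\<one>\<^bsub>K\<^esub> \<ominus>\<^bsub>K\<^esub> a))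
      ((\<one>\<^bsub>K\<^esub> \<ominus>\<^bsub>K\<^esub> h a) \<otimes>\<^bsub>K\<^esub> (\<one>\<^bsub>K\<^esub> \<ominus>\<^bsub>K\<^esub> h a))"
    using W0.loop_Q_iso_intertwines[OF W0.loop_Q_field_axioms W1.loop_Q_field_axioms]
    by metis
  interpret g: field_additive_bij K g
    by (rule g)
  have "{c. \<exists>d. W0.intertwines g c d} = carrier K"
    using squares by (intro tame_generated_by_squares[OF assms(4)] g.intertwined_subfield) auto
  then obtain \<phi> where \<phi>: "\<phi> \<in> ring_iso K K"
    and \<phi>_eq: "\<And>c d. W0.intertwines g c d \<Longrightarrow> \<phi> c = d"
    using g.ring_iso_if_all_intertwined by blast
  interpret \<phi>: ring_hom_cring K K \<phi>
    using \<phi> by unfold_locales (simp add: ring_iso_def)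
  have "\<phi> a = h a" if a: "a \<in> W\<^sub>0" for a
  proof (rule W0.eq_if_squares_eq)
    have ha: "h a \<in> carrier K"
      using a h_image W1.W_carrier by blast
    then show "h a \<in> carrier K" .
    show "\<phi> a \<in> carrier K"
      using a by simp
    show "(\<one>\<^bsub>K\<^esub> \<ominus>\<^bsub>K\<^esub> \<phi> a) \<otimes>\<^bsub>K\<^esub> (\<one>\<^bsub>K\<^esub> \<ominus>\<^bsub>K\<^esub> \<phi> a) =
        (\<one>\<^bsub>K\<^esub> \<ominus>\<^bsub>K\<^esub> h a) \<otimes>\<^bsub>K\<^esub> (\<one>\<^bsub>K\<^esub> \<ominus>\<^bsub>K\<^esub> h a)"
      using \<phi>_eq[OF squares[OF a]] a by (simp add: a_minus_def)
    show "(\<one>\<^bsub>K\<^esub> \<oplus>\<^bsub>K\<^esub> \<phi> a) \<otimes>\<^bsub>K\<^esub> (\<one>\<^bsub>K\<^esub> \<oplus>\<^bsub>K\<^esub> \<phi> a) =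
        (\<one>\<^bsub>K\<^esub> \<oplus>\<^bsub>K\<^esub> h a) \<otimes>\<^bsub>K\<^esub> (\<one>\<^bsub>K\<^esub> \<oplus>\<^bsub>K\<^esub> h a)"
      using \<phi>_eq[OF squares[OF W0.W_neg[OF a]]] a ha by (simp add: a_minus_def h_neg)
  qed
  then have "\<phi> ` W\<^sub>0 = W\<^sub>1"
    using h_image by (metis image_cong)
  then show "\<exists>\<phi>\<in>ring_iso K K. \<phi> ` W\<^sub>0 = W\<^sub>1"
    using \<phi> by blast
qed

end
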